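(* Let $L$ be a frame. The strictly zero-dimensional biframes over $L$ are precisely the dense quotients of the congruence biframe $\mathbb{C}L$. That is, a biframe $M$ is strictly zero-dimensional with first part isomorphic to $L$ if and only if there is a dense surjective biframe homomorphism $\mathbb{C}L\to M$.
   Context: A biframe is a triple $M=(M_0,M_1,M_2)$ where $M_0$ is a frame (the total part) and $M_1,M_2$ are subframes of $M_0$ (the first and second parts) whose union generates $M_0$. A biframe homomorphism $f:M\to N$ is a frame homomorphism $M_0\to N_0$ mapping $M_i$ into $N_i$ for $i=1,2$; it is surjective if its restrictions $M_i\to N_i$ ($i=1,2$) are surjective (and hence so is $M_0\to N_0$), and dense if the map on total parts sends only $0$ to $0$. A biframe $M$ is strictly zero-dimensional if every $a\in M_1$ is complemented in $M_0$ with its complement lying in $M_2$, and these complements generate $M_2$; one then says $M$ is a strictly zero-dimensional biframe over $M_1$ (the first part being considered up to isomorphism). For a frame $L$, let $\mathbb{C}L$ also denote the frame of all frame congruences on $L$ ordered by inclusion (a congruence is an equivalence relation closed under finite meets and arbitrary joins in $L\times L$). For $a\in L$ let $\nabla_a=\langle(0,a)\rangle$ and $\Delta_a=\langle(a,1)\rangle$ be the congruences generated by the indicated pairs. The congruence biframe is $\mathbb{C}L=(\mathbb{C}L,\nabla L,\Delta L)$ where $\nabla L=\{\nabla_a\mid a\in L\}$ (isomorphic to $L$) and $\Delta L$ is the subframe generated by $\{\Delta_a\mid a\in L\}$. *)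

theory Defs
  imports "HOL.Hull" "HOL-Library.Product_Order"
begin

section \<open>Frames\<close>

text \<open>
  The class \<^class>\<open>complete_distrib_lattice\<close> requires complete distributivity, which is strictly
  stronger than the frame law.
\<close>

class frame = complete_lattice +
  assumes inf_Sup_frame: "inf x (Sup A) = Sup (inf x ` A)"

definition frame_hom :: "('a::frame \<Rightarrow> 'b::frame) \<Rightarrow> bool" where
  "frame_hom f \<longleftrightarrow>
     f top = top \<and> (\<forall>x y. f (inf x y) = inf (f x) (f y)) \<and> (\<forall>A. f (Sup A) = Sup (f ` A))"

text \<open>
  Subframes contain \<^term>\<open>bot\<close>, as the join of the empty set.  The definition is given for all
  complete lattices only so that it applies to the product order on \<open>'a \<times> 'a\<close>.
\<close>

definition subframe :: "'a::complete_lattice set \<Rightarrow> bool" where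
  "subframe S \<longleftrightarrow>
     top \<in> S \<and> (\<forall>x\<in>S. \<forall>y\<in>S. inf x y \<in> S) \<and> (\<forall>A. A \<subseteq> S \<longrightarrow> Sup A \<in> S)"

text \<open>The subframe generated by a set \<open>A\<close> is \<open>subframe hull A\<close>.\<close>

lemma subframe_hull: "subframe (subframe hull A)"
  unfolding subframe_def hull_def by blast

lemma subframe_inf: "subframe S \<Longrightarrow> x \<in> S \<Longrightarrow> y \<in> S \<Longrightarrow> inf x y \<in> S"
  by (simp add: subframe_def)

lemma subframe_Sup: "subframe S \<Longrightarrow> A \<subseteq> S \<Longrightarrow> Sup A \<in> S"
  by (simp add: subframe_def)

text \<open>
  An isomorphism from a frame onto a subframe \<open>S\<close> of a frame; meets and joins in \<open>S\<close> are those of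
  the ambient frame.
\<close>

definition frame_iso_onto :: "('a::frame \<Rightarrow> 'b::frame) \<Rightarrow> 'b set \<Rightarrow> bool" where
  "frame_iso_onto g S \<longleftrightarrow> frame_hom g \<and> bij_betw g UNIV S"

section \<open>Biframes\<close>

text \<open>The total part of a biframe is the whole type \<open>'a\<close>.\<close>

record 'a biframe_parts =
  first_part :: "'a set"
  second_part :: "'a set"

definition biframe :: "'a::frame biframe_parts \<Rightarrow> bool" where
  "biframe M \<longleftrightarrow>
     subframe (first_part M) \<and> subframe (second_part M) \<and>
     subframe hull (first_part M \<union> second_part M) = UNIV"

definition biframe_hom ::
    "'a::frame biframe_parts \<Rightarrow> 'b::frame biframe_parts \<Rightarrow> ('a \<Rightarrow> 'b) \<Rightarrow> bool" where
  "biframe_hom M N f \<longleftrightarrow>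
     frame_hom f \<and> f ` first_part M \<subseteq> first_part N \<and> f ` second_part M \<subseteq> second_part N"

definition biframe_surj ::
    "'a::frame biframe_parts \<Rightarrow> 'b::frame biframe_parts \<Rightarrow> ('a \<Rightarrow> 'b) \<Rightarrow> bool" where
  "biframe_surj M N f \<longleftrightarrow>
     f ` first_part M = first_part N \<and> f ` second_part M = second_part N"

definition dense_map :: "('a::frame \<Rightarrow> 'b::frame) \<Rightarrow> bool" where
  "dense_map f \<longleftrightarrow> (\<forall>x. f x = bot \<longrightarrow> x = bot)"

definition is_complement :: "'a::bounded_lattice \<Rightarrow> 'a \<Rightarrow> bool" where
  "is_complement a c \<longleftrightarrow> inf a c = bot \<and> sup a c = top"

definition strictly_zero_dimensional :: "'a::frame biframe_parts \<Rightarrow> bool" where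
  "strictly_zero_dimensional M \<longleftrightarrow>
     (\<forall>a\<in>first_part M. \<exists>c\<in>second_part M. is_complement a c) \<and>
     second_part M = subframe hull {c. \<exists>a\<in>first_part M. is_complement a c}"

section \<open>Frame congruences\<close>

definition frame_congruence :: "('a::frame \<times> 'a) set \<Rightarrow> bool" where
  "frame_congruence r \<longleftrightarrow> equiv UNIV r \<and> subframe r"

lemma frame_congruence_altdef:
  "frame_congruence r \<longleftrightarrow> equiv UNIV r \<and>
     (\<forall>a b c d. (a, b) \<in> r \<longrightarrow> (c, d) \<in> r \<longrightarrow> (inf a c, inf b d) \<in> r) \<and>
     (\<forall>A. A \<subseteq> r \<longrightarrow> (Sup (fst ` A), Sup (snd ` A)) \<in> r)"
proof -
  have "(top, top) \<in> r" if "equiv UNIV r"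
    using that by (auto simp: equiv_def refl_on_def)
  then show ?thesis
    unfolding frame_congruence_def subframe_def
    by (auto simp: top_prod_def inf_prod_def Sup_prod_def Ball_def split_paired_all)
qed

lemma frame_congruence_Inter:
  assumes "\<And>r. r \<in> R \<Longrightarrow> frame_congruence r"
  shows "frame_congruence (\<Inter> R)"
  unfolding frame_congruence_def
proof
  have e: "equiv UNIV r" if "r \<in> R" for r using assms[OF that] by (simp add: frame_congruence_def)
  show "equiv UNIV (\<Inter> R)"
  proof (rule equivI)
    show "refl (\<Inter> R)" using e by (auto simp: equiv_def refl_on_def)
    show "sym (\<Inter> R)" using e unfolding equiv_def sym_def by blast
    show "trans (\<Inter> R)" using e unfolding equiv_def trans_def by blast
  qed auto
  show "subframe (\<Inter> R)"
    using assms unfolding frame_congruence_def subframe_def by blast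
qed

lemma frame_congruence_UNIV: "frame_congruence UNIV"
  using frame_congruence_Inter[of "{}"] by simp

typedef (overloaded) 'a::frame congruence = "{r :: ('a \<times> 'a) set. frame_congruence r}"
  morphisms rel Abs_congruence
  using frame_congruence_UNIV by blast

lemma frame_congruence_rel [simp]: "frame_congruence (rel \<theta>)"
  using rel by blast

instantiation congruence :: (frame) complete_lattice
begin

definition less_eq_congruence :: "'a congruence \<Rightarrow> 'a congruence \<Rightarrow> bool" where
  "\<theta> \<le> \<phi> \<longleftrightarrow> rel \<theta> \<subseteq> rel \<phi>"

definition less_congruence :: "'a congruence \<Rightarrow> 'a congruence \<Rightarrow> bool" where
  "\<theta> < \<phi> \<longleftrightarrow> rel \<theta> \<subset> rel \<phi>"

definition Inf_congruence :: "'a congruence set \<Rightarrow> 'a congruence" where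
  "Inf S = Abs_congruence (\<Inter> (rel ` S))"

definition Sup_congruence :: "'a congruence set \<Rightarrow> 'a congruence" where
  "Sup S = Inf {\<phi> :: 'a congruence. \<forall>\<theta>\<in>S. \<theta> \<le> \<phi>}"

definition inf_congruence :: "'a congruence \<Rightarrow> 'a congruence \<Rightarrow> 'a congruence" where
  "inf \<theta> \<phi> = Inf {(\<theta> :: 'a congruence), \<phi>}"

definition sup_congruence :: "'a congruence \<Rightarrow> 'a congruence \<Rightarrow> 'a congruence" where
  "sup \<theta> \<phi> = Sup {(\<theta> :: 'a congruence), \<phi>}"

definition top_congruence :: "'a congruence" where
  "top = Inf ({} :: 'a congruence set)"

definition bot_congruence :: "'a congruence" where
  "bot = Sup ({} :: 'a congruence set)"

lemma rel_Inf: "rel (Inf S) = \<Inter> (rel ` S)"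
  unfolding Inf_congruence_def
  by (rule Abs_congruence_inverse) (auto intro!: frame_congruence_Inter)

instance
proof
  fix x y z :: "'a congruence" and A :: "'a congruence set"
  show "x < y \<longleftrightarrow> x \<le> y \<and> \<not> y \<le> x"
    by (auto simp: less_eq_congruence_def less_congruence_def)
  show "x \<le> x" by (simp add: less_eq_congruence_def)
  show "x \<le> y \<Longrightarrow> y \<le> z \<Longrightarrow> x \<le> z" by (auto simp: less_eq_congruence_def)
  show "x \<le> y \<Longrightarrow> y \<le> x \<Longrightarrow> x = y" by (auto simp: less_eq_congruence_def rel_inject[symmetric])
  have Inf_lower: "v \<in> B \<Longrightarrow> Inf B \<le> v" for B and v :: "'a congruence"
    by (auto simp: less_eq_congruence_def rel_Inf)
  have Inf_greatest: "(\<And>v. v \<in> B \<Longrightarrow> u \<le> v) \<Longrightarrow> u \<le> Inf B" for B and u :: "'a congruence"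
    by (auto simp: less_eq_congruence_def rel_Inf)
  have Sup_upper: "v \<in> B \<Longrightarrow> v \<le> Sup B" for B and v :: "'a congruence"
    unfolding Sup_congruence_def by (rule Inf_greatest) blast
  have Sup_least: "(\<And>v. v \<in> B \<Longrightarrow> v \<le> u) \<Longrightarrow> Sup B \<le> u" for B and u :: "'a congruence"
    unfolding Sup_congruence_def by (rule Inf_lower) blast
  show "x \<in> A \<Longrightarrow> Inf A \<le> x" by (rule Inf_lower)
  show "(\<And>x. x \<in> A \<Longrightarrow> z \<le> x) \<Longrightarrow> z \<le> Inf A" by (rule Inf_greatest)
  show "x \<in> A \<Longrightarrow> x \<le> Sup A" by (rule Sup_upper)
  show "(\<And>x. x \<in> A \<Longrightarrow> x \<le> z) \<Longrightarrow> Sup A \<le> z" by (rule Sup_least)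
  show "inf x y \<le> x" "inf x y \<le> y"
    unfolding inf_congruence_def by (auto intro: Inf_lower)
  show "x \<le> y \<Longrightarrow> x \<le> z \<Longrightarrow> x \<le> inf y z"
    unfolding inf_congruence_def by (rule Inf_greatest) auto
  show "x \<le> sup x y" "y \<le> sup x y"
    unfolding sup_congruence_def by (auto intro: Sup_upper)
  show "y \<le> x \<Longrightarrow> z \<le> x \<Longrightarrow> sup y z \<le> x"
    unfolding sup_congruence_def by (rule Sup_least) auto
  show "Inf {} = (top :: 'a congruence)" by (rule top_congruence_def[symmetric])
  show "Sup {} = (bot :: 'a congruence)" by (rule bot_congruence_def[symmetric])
qed

end

lemma rel_inf: "rel (inf \<theta> \<phi>) = rel \<theta> \<inter> rel \<phi>"
  unfolding inf_congruence_def rel_Inf by simp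

lemma rel_refl: "(x, x) \<in> rel \<theta>"
  using frame_congruence_rel[of \<theta>] by (auto simp: frame_congruence_altdef equiv_def refl_on_def)

lemma rel_sym: "(x, y) \<in> rel \<theta> \<Longrightarrow> (y, x) \<in> rel \<theta>"
  using frame_congruence_rel[of \<theta>] by (auto simp: frame_congruence_altdef equiv_def sym_def)

lemma rel_trans: "(x, y) \<in> rel \<theta> \<Longrightarrow> (y, z) \<in> rel \<theta> \<Longrightarrow> (x, z) \<in> rel \<theta>"
  using frame_congruence_rel[of \<theta>] unfolding frame_congruence_altdef equiv_def trans_def by blast

lemma rel_meet: "(a, b) \<in> rel \<theta> \<Longrightarrow> (c, d) \<in> rel \<theta> \<Longrightarrow> (inf a c, inf b d) \<in> rel \<theta>"
  using frame_congruence_rel[of \<theta>] unfolding frame_congruence_altdef by blast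

lemma rel_Join: "A \<subseteq> rel \<theta> \<Longrightarrow> (Sup (fst ` A), Sup (snd ` A)) \<in> rel \<theta>"
  using frame_congruence_rel[of \<theta>] unfolding frame_congruence_altdef by blast

lemma rel_join: "(a, b) \<in> rel \<theta> \<Longrightarrow> (c, d) \<in> rel \<theta> \<Longrightarrow> (sup a c, sup b d) \<in> rel \<theta>"
  using rel_Join[of "{(a, b), (c, d)}"] by simp

lemma sup_SUP_absorb:
  fixes c :: "'a::complete_lattice"
  shows "sup (SUP x\<in>X. sup (g x) c) c = sup (SUP x\<in>X. g x) c"
proof (rule antisym)
  have "sup (g x) c \<le> sup (SUP x\<in>X. g x) c" if "x \<in> X" for x
    using that by (intro sup.mono SUP_upper order_refl)
  then show "sup (SUP x\<in>X. sup (g x) c) c \<le> sup (SUP x\<in>X. g x) c"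
    by (simp add: SUP_least)
  show "sup (SUP x\<in>X. g x) c \<le> sup (SUP x\<in>X. sup (g x) c) c"
    by (intro sup.mono SUP_mono') simp_all
qed

lemma frame_inf_sup_distrib: "inf x (sup y z) = sup (inf x y) (inf x (z::'a::frame))"
  using inf_Sup_frame[of x "{y, z}"] by simp

instance frame \<subseteq> distrib_lattice
  by standard (rule distrib_imp1, rule frame_inf_sup_distrib)

text \<open>
  The relation used here is the Heyting implication of \<open>\<theta>\<close> and \<open>\<psi>\<close> in the lattice of
  congruences.
\<close>

lemma congruence_implication:
  fixes \<theta> \<psi> :: "'a::frame congruence"
  defines "r \<equiv> {(a, b). \<forall>(c, d)\<in>rel \<theta>. c \<le> d \<longrightarrow>
      (sup (inf a d) c, sup (inf b d) c) \<in> rel \<psi>}"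
  shows "frame_congruence r"
  unfolding frame_congruence_altdef
proof (intro conjI allI impI)
  show "equiv UNIV r"
  proof (rule equivI)
    show "refl r" by (auto simp: r_def refl_on_def rel_refl)
    show "sym r" by (auto simp: r_def sym_def intro: rel_sym)
    show "trans r" unfolding r_def trans_def by (fast intro: rel_trans)
  qed auto
next
  fix a b a' b'
  assume 1: "(a, b) \<in> r" "(a', b') \<in> r"
  have "(sup (inf (inf a a') d) c, sup (inf (inf b b') d) c) \<in> rel \<psi>"
    if cd: "(c, d) \<in> rel \<theta>" "c \<le> d" for c d
  proof -
    have *: "sup (inf (inf x y) d) c = inf (sup (inf x d) c) (sup (inf y d) c)" for x y
    proof -
      have "inf (inf x y) d = inf (inf x d) (inf y d)" by (simp add: inf_aci)
      then show ?thesis by (simp add: sup_inf_distrib2)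
    qed
    show ?thesis unfolding * by (rule rel_meet) (use 1 cd in \<open>auto simp: r_def\<close>)
  qed
  then show "(inf a a', inf b b') \<in> r" by (auto simp: r_def)
next
  fix A assume A: "A \<subseteq> r"
  have "(sup (inf (Sup (fst ` A)) d) c, sup (inf (Sup (snd ` A)) d) c) \<in> rel \<psi>"
    if cd: "(c, d) \<in> rel \<theta>" "c \<le> d" for c d
  proof -
    have *: "sup (inf (Sup X) d) c = sup (Sup ((\<lambda>x. sup (inf x d) c) ` X)) c" for X
      unfolding inf_commute[of _ d] inf_Sup_frame by (rule sup_SUP_absorb[symmetric])
    let ?B = "(\<lambda>(a, b). (sup (inf a d) c, sup (inf b d) c)) ` A"
    have "?B \<subseteq> rel \<psi>" using A cd by (auto simp: r_def)
    from rel_join[OF rel_Join[OF this] rel_refl[of c]]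
    show ?thesis by (simp add: * image_image case_prod_unfold)
  qed
  then show "(Sup (fst ` A), Sup (snd ` A)) \<in> r" by (auto simp: r_def)
qed

instance congruence :: (frame) frame
proof
  fix \<theta> :: "'a congruence" and S :: "'a congruence set"
  define \<psi> where "\<psi> = Sup (inf \<theta> ` S)"
  define r where "r = {(a, b). \<forall>(c, d)\<in>rel \<theta>. c \<le> d \<longrightarrow>
      (sup (inf a d) c, sup (inf b d) c) \<in> rel \<psi>}"
  define \<chi> where "\<chi> = Abs_congruence r"
  have \<chi>: "rel \<chi> = r"
    unfolding \<chi>_def r_def using congruence_implication
    by (intro Abs_congruence_inverse) blast
  have "\<phi> \<le> \<chi>" if "\<phi> \<in> S" for \<phi>
    unfolding less_eq_congruence_def
  proof
    fix p assume p: "p \<in> rel \<phi>"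
    obtain a b where ab: "p = (a, b)" by force
    have "(sup (inf a d) c, sup (inf b d) c) \<in> rel \<psi>" if cd: "(c, d) \<in> rel \<theta>" "c \<le> d" for c d
    proof -
      have 1: "(sup (inf a d) c, sup (inf b d) c) \<in> rel \<phi>"
        using p ab by (intro rel_join rel_meet rel_refl) auto
      have 2: "(sup (inf x d) c, d) \<in> rel \<theta>" for x
      proof -
        have "(sup (inf x d) c, sup (inf x d) d) \<in> rel \<theta>" by (intro rel_join rel_refl cd)
        moreover have "sup (inf x d) d = d" by (simp add: sup.absorb2)
        ultimately show ?thesis by simp
      qed
      have "(sup (inf a d) c, sup (inf b d) c) \<in> rel \<theta>"
        using 2 rel_sym rel_trans by blast
      with 1 have "(sup (inf a d) c, sup (inf b d) c) \<in> rel (inf \<theta> \<phi>)" by (simp add: rel_inf)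
      moreover have "inf \<theta> \<phi> \<le> \<psi>" unfolding \<psi>_def by (rule SUP_upper) fact
      ultimately show ?thesis by (auto simp: less_eq_congruence_def)
    qed
    then show "p \<in> rel \<chi>" by (auto simp: \<chi> r_def ab)
  qed
  then have S: "Sup S \<le> \<chi>" by (rule Sup_least)
  have "inf \<theta> \<chi> \<le> \<psi>"
    unfolding less_eq_congruence_def
  proof
    fix p assume p: "p \<in> rel (inf \<theta> \<chi>)"
    obtain a b where ab: "p = (a, b)" by force
    have \<theta>: "(a, b) \<in> rel \<theta>" and r: "(a, b) \<in> r"
      using p by (auto simp: ab rel_inf \<chi>)
    have "(inf a b, inf b b) \<in> rel \<theta>" "(sup a b, sup b b) \<in> rel \<theta>"
      using \<theta> rel_refl by (blast intro: rel_meet rel_join)+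
    then have "(inf a b, sup a b) \<in> rel \<theta>" using rel_sym rel_trans by fastforce
    moreover have "inf a b \<le> sup a b" by (simp add: le_infI1)
    ultimately have "(sup (inf a (sup a b)) (inf a b), sup (inf b (sup a b)) (inf a b)) \<in> rel \<psi>"
      using r by (auto simp: r_def)
    moreover have "sup (inf a (sup a b)) (inf a b) = a" "sup (inf b (sup a b)) (inf a b) = b"
      by (simp_all add: inf.absorb1 sup.absorb1)
    ultimately show "p \<in> rel \<psi>" by (simp add: ab)
  qed
  then have "inf \<theta> (Sup S) \<le> \<psi>" using S by (meson inf_mono order.trans order_refl)
  moreover have "\<psi> \<le> inf \<theta> (Sup S)"
    unfolding \<psi>_def by (intro SUP_least inf_mono order_refl Sup_upper)
  ultimately show "inf \<theta> (Sup S) = Sup (inf \<theta> ` S)" by (simp add: \<psi>_def antisym)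
qed

section \<open>The congruence biframe\<close>

definition generated_congruence :: "('a::frame \<times> 'a) set \<Rightarrow> 'a congruence" where
  "generated_congruence R = Inf {\<theta>. R \<subseteq> rel \<theta>}"

definition nabla :: "'a::frame \<Rightarrow> 'a congruence" where
  "nabla a = generated_congruence {(bot, a)}"

definition Delta :: "'a::frame \<Rightarrow> 'a congruence" where
  "Delta a = generated_congruence {(a, top)}"

definition congruence_biframe :: "'a::frame congruence biframe_parts" where
  "congruence_biframe = \<lparr>first_part = range nabla, second_part = subframe hull (range Delta)\<rparr>"

lemma rel_nabla: "rel (nabla a) = {(x, y). sup x a = sup y a}"
proof -
  let ?r = "{(x, y). sup x a = sup y a}"
  have c: "frame_congruence ?r"
    unfolding frame_congruence_altdef
  proof (intro conjI allI impI)
    show "equiv UNIV ?r" by (auto intro!: equivI simp: refl_on_def sym_def trans_def)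
    show "(Sup (fst ` A), Sup (snd ` A)) \<in> ?r" if A: "A \<subseteq> ?r" for A
    proof -
      have *: "sup (Sup X) a = sup (Sup ((\<lambda>x. sup x a) ` X)) a" for X :: "'a set"
        using sup_SUP_absorb[of "\<lambda>x. x" a X] by simp
      have "(\<lambda>p. sup (fst p) a) ` A = (\<lambda>p. sup (snd p) a) ` A"
        using A by (intro image_cong) auto
      then show ?thesis by (simp add: *[of "fst ` A"] *[of "snd ` A"] image_image)
    qed
  qed (simp add: sup_inf_distrib2)
  have "nabla a \<le> Abs_congruence ?r"
    unfolding nabla_def generated_congruence_def
    by (rule Inf_lower) (use c in \<open>simp add: Abs_congruence_inverse\<close>)
  then have "rel (nabla a) \<subseteq> ?r" using c by (simp add: less_eq_congruence_def Abs_congruence_inverse)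
  moreover have "?r \<subseteq> rel (nabla a)"
  proof clarify
    fix x y assume xy: "sup x a = sup y a"
    have g: "(bot, a) \<in> rel (nabla a)"
      by (auto simp: nabla_def generated_congruence_def rel_Inf)
    have "(z, sup z a) \<in> rel (nabla a)" for z
      using rel_join[OF rel_refl[of z] g] by simp
    then show "(x, y) \<in> rel (nabla a)" using xy rel_sym rel_trans by metis
  qed
  ultimately show ?thesis by blast
qed

lemma rel_Delta: "rel (Delta a) = {(x, y). inf x a = inf y a}"
proof -
  let ?r = "{(x, y). inf x a = inf y a}"
  have c: "frame_congruence ?r"
    unfolding frame_congruence_altdef
  proof (intro conjI allI impI)
    show "equiv UNIV ?r" by (auto intro!: equivI simp: refl_on_def sym_def trans_def)
    show "(inf x z, inf y w) \<in> ?r" if "(x, y) \<in> ?r" "(z, w) \<in> ?r" for x y z w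
      using that by auto (metis inf_assoc inf_commute)
    show "(Sup (fst ` A), Sup (snd ` A)) \<in> ?r" if A: "A \<subseteq> ?r" for A
    proof -
      have "(\<lambda>p. inf a (fst p)) ` A = (\<lambda>p. inf a (snd p)) ` A"
        using A by (intro image_cong) (auto simp: inf_commute)
      then show ?thesis by (simp add: inf_commute[of _ a] inf_Sup_frame image_image)
    qed
  qed
  have "Delta a \<le> Abs_congruence ?r"
    unfolding Delta_def generated_congruence_def
    by (rule Inf_lower) (use c in \<open>simp add: Abs_congruence_inverse\<close>)
  then have "rel (Delta a) \<subseteq> ?r" using c by (simp add: less_eq_congruence_def Abs_congruence_inverse)
  moreover have "?r \<subseteq> rel (Delta a)"
  proof clarify
    fix x y assume xy: "inf x a = inf y a"
    have g: "(a, top) \<in> rel (Delta a)"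
      by (auto simp: Delta_def generated_congruence_def rel_Inf)
    have "(inf z a, z) \<in> rel (Delta a)" for z
      using rel_meet[OF rel_refl[of z] g] by simp
    then show "(x, y) \<in> rel (Delta a)" using xy rel_sym rel_trans by metis
  qed
  ultimately show ?thesis by blast
qed

lemma nabla_le_iff: "nabla a \<le> \<theta> \<longleftrightarrow> (bot, a) \<in> rel \<theta>"
proof
  assume "nabla a \<le> \<theta>"
  then show "(bot, a) \<in> rel \<theta>" by (auto simp: less_eq_congruence_def rel_nabla)
next
  assume "(bot, a) \<in> rel \<theta>"
  then show "nabla a \<le> \<theta>" unfolding nabla_def generated_congruence_def by (auto intro: Inf_lower)
qed

lemma frame_hom_nabla: "frame_hom nabla"
  unfolding frame_hom_def
proof (intro conjI allI)
  show "nabla top = (top :: 'a congruence)"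
    by (intro top_le) (auto simp: less_eq_congruence_def rel_nabla)
  show "nabla (inf a b) = inf (nabla a) (nabla b)" for a b :: 'a
  proof -
    have "sup x (inf a b) = sup y (inf a b) \<longleftrightarrow> sup x a = sup y a \<and> sup x b = sup y b" for x y
    proof
      assume "sup x (inf a b) = sup y (inf a b)"
      then have "sup (sup x (inf a b)) z = sup (sup y (inf a b)) z" for z by simp
      from this[of a] this[of b] show "sup x a = sup y a \<and> sup x b = sup y b"
        by (simp add: sup_assoc sup.absorb2)
    qed (simp add: sup_inf_distrib1)
    then show ?thesis by (auto simp: rel_inject[symmetric] rel_inf rel_nabla)
  qed
  show "nabla (Sup A) = Sup (nabla ` A)" for A :: "'a set"
  proof (rule antisym)
    have "(bot, a) \<in> rel (Sup (nabla ` A))" if "a \<in> A" for a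
      using that by (auto simp: nabla_le_iff[symmetric] intro: SUP_upper)
    then have "(\<lambda>a. (bot, a)) ` A \<subseteq> rel (Sup (nabla ` A))" by auto
    from rel_Join[OF this] have "(Sup ((\<lambda>_. bot) ` A), Sup A) \<in> rel (Sup (nabla ` A))"
      by (simp add: image_image)
    moreover have "Sup ((\<lambda>_. bot) ` A) = (bot :: 'a)" by (auto simp: bot_unique intro!: SUP_least)
    ultimately show "nabla (Sup A) \<le> Sup (nabla ` A)" by (simp add: nabla_le_iff)
    show "Sup (nabla ` A) \<le> nabla (Sup A)"
      by (auto intro!: SUP_least sup.absorb2[symmetric] Sup_upper simp: nabla_le_iff rel_nabla)
  qed
qed

lemma nabla_inj: "inj nabla"
proof (rule injI)
  fix a b :: 'a assume eq: "nabla a = nabla b"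
  have "(bot, a) \<in> rel (nabla b)" "(bot, b) \<in> rel (nabla a)"
    using nabla_le_iff[of a "nabla b"] nabla_le_iff[of b "nabla a"] eq by simp_all
  then have "sup a b = b" "sup b a = a" by (simp_all add: rel_nabla)
  then show "a = b" by (simp add: sup_commute)
qed

lemma nabla_iso_onto_first_part: "frame_iso_onto nabla (first_part congruence_biframe)"
  by (simp add: frame_iso_onto_def frame_hom_nabla congruence_biframe_def bij_betw_def nabla_inj)

lemma biframe_congruence_biframe: "biframe (congruence_biframe :: 'a::frame congruence biframe_parts)"
  unfolding biframe_def
proof (intro conjI)
  have hom: "frame_hom (nabla :: 'a \<Rightarrow> _)" by (rule frame_hom_nabla)
  have "Sup A \<in> range nabla" if "A \<subseteq> range nabla" for A :: "'a congruence set"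
  proof -
    from that obtain B where "A = nabla ` B" by (auto simp: subset_image_iff)
    then have "Sup A = nabla (Sup B)" using hom by (simp add: frame_hom_def)
    then show ?thesis by simp
  qed
  moreover have "top \<in> range (nabla :: 'a \<Rightarrow> _)"
    using hom unfolding frame_hom_def by (metis rangeI)
  moreover have "inf (nabla a) (nabla b) \<in> range nabla" for a b :: 'a
    using hom unfolding frame_hom_def by (metis rangeI)
  ultimately show "subframe (first_part (congruence_biframe :: 'a congruence biframe_parts))"
    by (auto simp: subframe_def congruence_biframe_def)
  show "subframe (second_part (congruence_biframe :: 'a congruence biframe_parts))"
    by (simp add: congruence_biframe_def subframe_hull)
  let ?G = "subframe hull (first_part congruence_biframe \<union> second_part congruence_biframe)
    :: 'a congruence set"
  have "\<theta> \<in> ?G" for \<theta> :: "'a congruence"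
  proof -
    define T where "T = (\<lambda>(a, b). inf (nabla b) (Delta a)) ` {(a, b) \<in> rel \<theta>. a \<le> b}"
    have n: "nabla b \<in> ?G" for b
      by (rule subsetD[OF hull_subset]) (auto simp: congruence_biframe_def)
    have d: "Delta b \<in> ?G" for b
      by (rule subsetD[OF hull_subset])
        (auto simp: congruence_biframe_def intro: subsetD[OF hull_subset])
    have "T \<subseteq> ?G"
    proof
      fix \<phi> assume "\<phi> \<in> T"
      then obtain a b where \<phi>: "\<phi> = inf (nabla b) (Delta a)" by (auto simp: T_def)
      show "\<phi> \<in> ?G"
        unfolding \<phi> by (rule subframe_inf[OF subframe_hull n d])
    qed
    then have "Sup T \<in> ?G" by (rule subframe_Sup[OF subframe_hull])
    moreover have "Sup T = \<theta>"
    proof (rule antisym)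
      have "inf (nabla b) (Delta a) \<le> \<theta>" if ab: "(a, b) \<in> rel \<theta>" for a b
        unfolding less_eq_congruence_def rel_inf rel_nabla rel_Delta
      proof clarify
        fix x y assume xy: "sup x b = sup y b" "inf x a = inf y a"
        have *: "(z, sup (inf z a) (inf z w)) \<in> rel \<theta>" if "w = sup z b \<or> sup w b = sup z b" for z w
        proof -
          have 1: "(sup w a, sup w b) \<in> rel \<theta>" by (intro rel_join rel_refl ab)
          have "(inf z (sup w a), inf z (sup w b)) \<in> rel \<theta>" by (intro rel_meet rel_refl 1)
          moreover have "inf z (sup w b) = z" using that by (auto simp: inf.absorb1 le_supI1)
          ultimately show ?thesis by (simp add: inf_sup_distrib1 sup_commute rel_sym)
        qed
        have "(x, sup (inf x a) (inf x y)) \<in> rel \<theta>" "(y, sup (inf y a) (inf y x)) \<in> rel \<theta>"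
          using xy by (intro *; simp)+
        then show "(x, y) \<in> rel \<theta>" using xy rel_sym rel_trans by (metis inf_commute)
      qed
      then show "Sup T \<le> \<theta>" by (auto simp: T_def intro!: Sup_least)
      have le: "(a, b) \<in> rel (Sup T)" if "(a, b) \<in> rel \<theta>" "a \<le> b" for a b
      proof -
        have "inf (nabla b) (Delta a) \<le> Sup T"
          by (rule Sup_upper) (use that in \<open>auto simp: T_def\<close>)
        moreover have "(a, b) \<in> rel (inf (nabla b) (Delta a))"
          using that by (simp add: rel_inf rel_nabla rel_Delta sup.absorb2 inf.absorb2)
        ultimately show ?thesis by (auto simp: less_eq_congruence_def)
      qed
      show "\<theta> \<le> Sup T"
        unfolding less_eq_congruence_def
      proof clarify
        fix a b assume ab: "(a, b) \<in> rel \<theta>"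
        have "(inf a b, a) \<in> rel (Sup T)"
          using rel_meet[OF rel_refl[of a] rel_sym[OF ab]] by (intro le) auto
        moreover have "(inf a b, b) \<in> rel (Sup T)"
          using rel_meet[OF ab rel_refl[of b]] by (intro le) auto
        ultimately show "(a, b) \<in> rel (Sup T)" using rel_sym rel_trans by blast
      qed
    qed
    ultimately show ?thesis by simp
  qed
  then show "?G = UNIV" by blast
qed

end

theory Submission
  imports Defs
begin

text \<open>
  The congruence frame freely complements the elements of \<open>L\<close>: a frame homomorphism \<open>g\<close> from \<open>L\<close>
  to \<open>M\<close> whose values have complements \<open>c a\<close> extends along \<^const>\<open>nabla\<close> to the frame homomorphism
  \<open>extension g c\<close>, which sends a congruence to the join of the differences \<open>g b \<sqinter> c a\<close> of its
  pairs \<open>(a, b)\<close>.  Its right adjoint sends \<open>m\<close> to the pullback along \<open>g\<close> of the congruence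
  \<^term>\<open>nabla m\<close>, so joins are preserved; finite meets are preserved because two differences meet in
  a difference that comes from a pair common to both congruences (\<open>frame_hom_extension\<close>).

  Since \<open>nabla a\<close> and \<open>Delta a\<close> are complements, any homomorphism \<open>f\<close> on the congruence frame sends
  \<open>Delta a\<close> to the unique complement of \<open>f (nabla a)\<close>.  Hence, once the image of \<open>nabla\<close> is the
  first part of \<open>M\<close>, the image of the second part of the congruence biframe is the subframe
  generated by the complements of the first part of \<open>M\<close>; so surjectivity on second parts says
  precisely that \<open>M\<close> is strictly zero-dimensional (\<open>hom_image_second_part\<close>).  Finally, density of
  \<open>f\<close> corresponds to injectivity of \<open>f \<circ> nabla\<close>: the difference \<open>nabla b \<sqinter> Delta a\<close> is killed
  as soon as \<open>a\<close> and \<open>b\<close> are identified, and conversely \<open>extension g c\<close> kills a congruence only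
  if \<open>g\<close> identifies all its pairs.
\<close>

section \<open>Complements and the bounds of the congruence frame\<close>

text \<open>Meeting with a complement of \<open>p\<close> is subtraction of \<open>p\<close>.\<close>

lemma inf_complement_le_iff:
  fixes p c x y :: "'a::{distrib_lattice, bounded_lattice}"
  assumes "is_complement p c"
  shows "inf x c \<le> y \<longleftrightarrow> x \<le> sup p y"
proof
  assume "inf x c \<le> y"
  have "x = inf x (sup p c)" using assms by (simp add: is_complement_def)
  also have "\<dots> = sup (inf x p) (inf x c)" by (rule inf_sup_distrib1)
  also have "\<dots> \<le> sup p y" using \<open>inf x c \<le> y\<close> by (intro sup.mono) simp_all
  finally show "x \<le> sup p y" .
next
  assume "x \<le> sup p y"
  then have "inf x c \<le> inf (sup p y) c" by (rule inf_mono) simp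
  also have "\<dots> = sup (inf p c) (inf y c)" by (rule inf_sup_distrib2)
  also have "\<dots> = inf y c" using assms by (simp add: is_complement_def)
  also have "\<dots> \<le> y" by simp
  finally show "inf x c \<le> y" .
qed

lemma complement_unique:
  fixes p c d :: "'a::{distrib_lattice, bounded_lattice}"
  assumes "is_complement p c" "is_complement p d"
  shows "c = d"
proof (rule antisym)
  show "c \<le> d"
    using inf_complement_le_iff[OF assms(1), of top d] assms(2) by (simp add: is_complement_def)
  show "d \<le> c"
    using inf_complement_le_iff[OF assms(2), of top c] assms(1) by (simp add: is_complement_def)
qed

lemma rel_bot: "rel (bot :: 'a::frame congruence) = Id"
proof -
  have "frame_congruence (Id :: ('a \<times> 'a) set)"
  proof -
    have "fst ` A = snd ` A" if "A \<subseteq> Id" for A :: "('a \<times> 'a) set"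
      using that by (intro image_cong) auto
    then show ?thesis
      by (auto simp: frame_congruence_altdef equiv_def refl_on_def sym_def trans_def)
  qed
  then have "rel (Abs_congruence (Id :: ('a \<times> 'a) set)) = Id"
    by (simp add: Abs_congruence_inverse)
  moreover have "bot \<le> Abs_congruence (Id :: ('a \<times> 'a) set)" by (rule bot_least)
  ultimately have "rel (bot :: 'a congruence) \<subseteq> Id" by (simp add: less_eq_congruence_def)
  then show ?thesis by (auto simp: rel_refl)
qed

lemma rel_top: "rel (top :: 'a::frame congruence) = UNIV"
  unfolding top_congruence_def rel_Inf by simp

lemma nabla_Delta_complement: "is_complement (nabla (a :: 'a::frame)) (Delta a)"
  unfolding is_complement_def
proof
  have "x = y" if eq: "sup x a = sup y a" "inf x a = inf y a" for x y
  proof -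
    have "x = inf x (sup y a)" by (simp flip: eq(1))
    also have "\<dots> = sup (inf x y) (inf y a)" by (simp add: inf_sup_distrib1 eq(2))
    also have "\<dots> = inf y (sup x a)" by (simp add: inf_sup_distrib1 inf_commute)
    also have "\<dots> = y" by (simp add: eq(1))
    finally show ?thesis .
  qed
  then have "rel (inf (nabla a) (Delta a)) = Id"
    by (auto simp: rel_inf rel_nabla rel_Delta)
  then show "inf (nabla a) (Delta a) = bot" by (simp add: rel_inject[symmetric] rel_bot)
  let ?s = "sup (nabla a) (Delta a)"
  have "rel (nabla a) \<subseteq> rel ?s" "rel (Delta a) \<subseteq> rel ?s"
    using sup_ge1[of "nabla a" "Delta a"] sup_ge2[of "Delta a" "nabla a"]
    by (simp_all add: less_eq_congruence_def)
  moreover have "(bot, a) \<in> rel (nabla a)" "(a, top) \<in> rel (Delta a)"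
    by (simp_all add: rel_nabla rel_Delta)
  ultimately have "(bot, top) \<in> rel ?s" using rel_trans by blast
  then have "nabla top \<le> ?s" by (simp add: nabla_le_iff)
  then show "?s = top" using frame_hom_nabla[where 'a = 'a] by (simp add: frame_hom_def top_unique)
qed

section \<open>Frame homomorphisms\<close>

lemma frame_hom_Sup: "frame_hom f \<Longrightarrow> f (Sup A) = Sup (f ` A)"
  by (simp add: frame_hom_def)

lemma frame_hom_inf: "frame_hom f \<Longrightarrow> f (inf x y) = inf (f x) (f y)"
  by (simp add: frame_hom_def)

lemma frame_hom_top: "frame_hom f \<Longrightarrow> f top = top"
  by (simp add: frame_hom_def)

lemma frame_hom_sup: "frame_hom f \<Longrightarrow> f (sup x y) = sup (f x) (f y)"
  using frame_hom_Sup[of f "{x, y}"] by simp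

lemma frame_hom_bot: "frame_hom f \<Longrightarrow> f bot = bot"
  using frame_hom_Sup[of f "{}"] by simp

lemma frame_hom_complement:
  assumes f: "frame_hom f" and xy: "is_complement x y"
  shows "is_complement (f x) (f y)"
  using xy unfolding is_complement_def
  by (simp flip: frame_hom_inf[OF f] frame_hom_sup[OF f]
      add: frame_hom_bot[OF f] frame_hom_top[OF f])

lemma frame_hom_image_hull:
  assumes f: "frame_hom f"
  shows "f ` (subframe hull A) = subframe hull (f ` A)"
proof
  have "subframe (f -` S)" if "subframe S" for S
    using f that unfolding subframe_def frame_hom_def by (auto simp: image_subset_iff_subset_vimage)
  then have "subframe (f -` (subframe hull (f ` A)))" using subframe_hull by blast
  then have "subframe hull A \<subseteq> f -` (subframe hull (f ` A))"
    by (rule hull_minimal[rotated]) (auto intro: subsetD[OF hull_subset])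
  then show "f ` (subframe hull A) \<subseteq> subframe hull (f ` A)" by blast
  have "subframe (f ` S)" if S: "subframe S" for S
    unfolding subframe_def
  proof (intro conjI ballI allI impI)
    have "f top = top" "top \<in> S" using f S by (simp_all add: frame_hom_def subframe_def)
    then show "top \<in> f ` S" by force
    fix x y assume "x \<in> f ` S" "y \<in> f ` S"
    then obtain u v where "x = f u" "y = f v" "u \<in> S" "v \<in> S" by blast
    moreover from this have "inf x y = f (inf u v)" using f by (simp add: frame_hom_def)
    ultimately show "inf x y \<in> f ` S" using subframe_inf[OF S] by simp
  next
    fix B assume B: "B \<subseteq> f ` S"
    then obtain C where C: "C \<subseteq> S" "B = f ` C" by (auto simp: subset_image_iff)
    then have "Sup B = f (Sup C)" using f by (simp add: frame_hom_def)
    then show "Sup B \<in> f ` S" using subframe_Sup[OF S C(1)] by simp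
  qed
  then have "subframe (f ` (subframe hull A))" using subframe_hull by blast
  then show "subframe hull (f ` A) \<subseteq> f ` (subframe hull A)"
    by (rule hull_minimal[rotated]) (auto intro: subsetD[OF hull_subset])
qed

text \<open>
  Because complements are unique, the images of the \<open>Delta a\<close> are all the complements of elements
  of the image of the first part.
\<close>

lemma hom_image_second_part:
  assumes f: "frame_hom (f :: 'l::frame congruence \<Rightarrow> 'm::frame)"
  shows "f ` second_part congruence_biframe =
    subframe hull {c. \<exists>a\<in>f ` first_part congruence_biframe. is_complement a c}"
proof -
  have "is_complement (f (nabla a)) (f (Delta a))" for a
    by (rule frame_hom_complement[OF f nabla_Delta_complement])
  then have "f ` range Delta = {c. \<exists>a\<in>f ` range nabla. is_complement a c}"
    using complement_unique by blast
  then show ?thesis by (simp add: congruence_biframe_def frame_hom_image_hull[OF f])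
qed

lemma inj_hom_nabla_of_dense:
  assumes f: "frame_hom (f :: 'l::frame congruence \<Rightarrow> 'm::frame)" and dense: "dense_map f"
  shows "inj (f \<circ> nabla)"
proof (rule injI)
  have le: "nabla b \<le> nabla a" if eq: "f (nabla a) = f (nabla b)" for a b
  proof -
    have "f (inf (nabla b) (Delta a)) = f (inf (nabla a) (Delta a))"
      using f eq by (simp add: frame_hom_def)
    also have "\<dots> = bot"
      using nabla_Delta_complement[of a] frame_hom_bot[OF f] by (simp add: is_complement_def)
    finally have "inf (nabla b) (Delta a) = bot" using dense by (simp add: dense_map_def)
    then show ?thesis
      using inf_complement_le_iff[OF nabla_Delta_complement, of "nabla b" a bot] by simp
  qed
  fix a b assume "(f \<circ> nabla) a = (f \<circ> nabla) b"
  then have "nabla a = nabla b" by (intro antisym le) simp_all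
  then show "a = b" by (rule injD[OF nabla_inj])
qed

section \<open>The universal property of the congruence frame\<close>

definition extension ::
    "('l::frame \<Rightarrow> 'm::frame) \<Rightarrow> ('l \<Rightarrow> 'm) \<Rightarrow> 'l congruence \<Rightarrow> 'm" where
  "extension g c \<theta> = (SUP (a, b)\<in>rel \<theta>. inf (g b) (c a))"

lemma frame_congruence_pullback:
  assumes g: "frame_hom g"
  shows "frame_congruence {(a, b). (g a, g b) \<in> rel \<theta>}"
  unfolding frame_congruence_altdef
proof (intro conjI allI impI)
  show "equiv UNIV {(a, b). (g a, g b) \<in> rel \<theta>}"
  proof (rule equivI)
    show "refl {(a, b). (g a, g b) \<in> rel \<theta>}" by (simp add: refl_on_def rel_refl)
    show "sym {(a, b). (g a, g b) \<in> rel \<theta>}" by (simp add: sym_def rel_sym)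
    show "trans {(a, b). (g a, g b) \<in> rel \<theta>}"
      unfolding trans_def by (blast intro: rel_trans)
  qed simp
next
  fix A assume A: "A \<subseteq> {(a, b). (g a, g b) \<in> rel \<theta>}"
  have "(Sup (fst ` map_prod g g ` A), Sup (snd ` map_prod g g ` A)) \<in> rel \<theta>"
    by (rule rel_Join) (use A in auto)
  then show "(Sup (fst ` A), Sup (snd ` A)) \<in> {(a, b). (g a, g b) \<in> rel \<theta>}"
    using g by (simp add: frame_hom_def image_image)
qed (simp add: frame_hom_inf[OF g] rel_meet)

context
  fixes g c :: "'l::frame \<Rightarrow> 'm::frame"
  assumes g: "frame_hom g" and c: "\<And>a. is_complement (g a) (c a)"
begin

lemma extension_le_iff:
  "extension g c \<theta> \<le> m \<longleftrightarrow> (\<forall>(a, b)\<in>rel \<theta>. g b \<le> sup (g a) m)"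
  by (simp add: extension_def SUP_le_iff case_prod_unfold inf_complement_le_iff[OF c])

text \<open>
  The bound \<open>g b \<le> g a \<squnion> m\<close> for all pairs of a symmetric relation means that \<open>g a\<close> and \<open>g b\<close>
  agree modulo \<open>nabla m\<close>, so \<open>extension g c\<close> has a right adjoint.
\<close>

lemma extension_adjoint:
  "extension g c \<theta> \<le> m \<longleftrightarrow> \<theta> \<le> Abs_congruence {(a, b). (g a, g b) \<in> rel (nabla m)}"
proof -
  have "(\<forall>(a, b)\<in>rel \<theta>. g b \<le> sup (g a) m) \<longleftrightarrow> (\<forall>(a, b)\<in>rel \<theta>. sup (g a) m = sup (g b) m)"
    (is "?L \<longleftrightarrow> ?R")
  proof
    assume L: ?L
    have le: "sup (g b) m \<le> sup (g a) m" if "(a, b) \<in> rel \<theta>" for a b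
      using that L by auto
    have "sup (g a) m = sup (g b) m" if "(a, b) \<in> rel \<theta>" for a b
      by (rule antisym[OF le[OF rel_sym[OF that]] le[OF that]])
    then show ?R by blast
  next
    assume R: ?R
    have "g b \<le> sup (g b) m" for b by simp
    with R show ?L by fastforce
  qed
  moreover have "rel (Abs_congruence {(a, b). (g a, g b) \<in> rel (nabla m)}) =
      {(a, b). sup (g a) m = sup (g b) m}"
    using Abs_congruence_inverse[OF CollectI, OF frame_congruence_pullback[OF g, of "nabla m"]]
    by (simp add: rel_nabla)
  ultimately show ?thesis by (auto simp: extension_le_iff less_eq_congruence_def)
qed

lemma extension_Sup: "extension g c (Sup A) = Sup (extension g c ` A)"
proof -
  have "extension g c (Sup A) \<le> m \<longleftrightarrow> Sup (extension g c ` A) \<le> m" for m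
    by (simp add: extension_adjoint Sup_le_iff SUP_le_iff)
  then show ?thesis by (meson antisym order_refl)
qed

lemma extension_upper: "(a, b) \<in> rel \<theta> \<Longrightarrow> inf (g b) (c a) \<le> extension g c \<theta>"
  unfolding extension_def by (rule SUP_upper2[of "(a, b)"]) simp_all

lemma extension_mono: "\<theta> \<le> \<phi> \<Longrightarrow> extension g c \<theta> \<le> extension g c \<phi>"
  unfolding extension_def less_eq_congruence_def by (rule SUP_subset_mono) simp_all

text \<open>
  The meet of the differences of \<open>(a, b) \<in> \<theta>\<close> and \<open>(a', b') \<in> \<phi>\<close> is the difference of
  \<open>a \<squnion> a'\<close> and \<open>b \<sqinter> b'\<close>.  Joining the first pair with \<open>a'\<close>, or the second with \<open>a\<close>, and then
  meeting with \<open>b \<sqinter> b'\<close> gives in either case the pair of \<open>(a \<squnion> a') \<sqinter> (b \<sqinter> b')\<close> and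
  \<open>b \<sqinter> b'\<close>, which therefore lies in both congruences.
\<close>

lemma extension_inf_le:
  "inf (extension g c \<theta>) (extension g c \<phi>) \<le> extension g c (inf \<theta> \<phi>)"
proof -
  have diff: "inf (inf (g b) (c a)) (inf (g b') (c a')) \<le> extension g c (inf \<theta> \<phi>)"
    if ab: "(a, b) \<in> rel \<theta>" and ab': "(a', b') \<in> rel \<phi>" for a b a' b'
  proof -
    define e where "e = inf b b'"
    define d where "d = inf (sup a a') e"
    have "(d, inf (sup b a') e) \<in> rel \<theta>"
      unfolding d_def by (intro rel_meet rel_join rel_refl ab)
    moreover have "inf (sup b a') e = e"
      by (rule inf.absorb2) (simp add: e_def le_infI1 le_supI1)
    moreover have "(d, inf (sup a b') e) \<in> rel \<phi>"
      unfolding d_def by (intro rel_meet rel_join rel_refl ab')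
    moreover have "inf (sup a b') e = e"
      by (rule inf.absorb2) (simp add: e_def le_infI2 le_supI2)
    ultimately have "(d, e) \<in> rel (inf \<theta> \<phi>)" by (simp add: rel_inf)
    then have "inf (g e) (c d) \<le> extension g c (inf \<theta> \<phi>)" by (rule extension_upper)
    then have e: "g e \<le> sup (g d) (extension g c (inf \<theta> \<phi>))"
      using inf_complement_le_iff[OF c] by blast
    have "g d \<le> sup (g a) (g a')"
      using g frame_hom_sup[OF g, of a a'] by (simp add: d_def frame_hom_def)
    then have "sup (g d) (extension g c (inf \<theta> \<phi>))
        \<le> sup (sup (g a) (g a')) (extension g c (inf \<theta> \<phi>))"
      by (rule sup.mono) simp
    with e have "g e \<le> sup (sup (g a) (g a')) (extension g c (inf \<theta> \<phi>))" by (rule order_trans)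
    then have "g e \<le> sup (g a) (sup (g a') (extension g c (inf \<theta> \<phi>)))" by (simp add: sup_assoc)
    then have "inf (inf (g e) (c a)) (c a') \<le> extension g c (inf \<theta> \<phi>)"
      by (simp add: inf_complement_le_iff[OF c])
    moreover have "g e = inf (g b) (g b')" using g by (simp add: e_def frame_hom_def)
    ultimately show ?thesis by (simp add: inf_aci)
  qed
  have "inf (extension g c \<theta>) x = (SUP (a, b)\<in>rel \<theta>. inf (inf (g b) (c a)) x)" for \<theta> x
    unfolding extension_def inf_commute[of _ x] inf_Sup_frame image_image
    by (simp add: case_prod_unfold)
  moreover have "inf x (extension g c \<phi>) = (SUP (a, b)\<in>rel \<phi>. inf x (inf (g b) (c a)))" for \<phi> x
    unfolding extension_def inf_Sup_frame image_image by (simp add: case_prod_unfold)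
  ultimately show ?thesis using diff by (auto intro!: SUP_least)
qed

lemma frame_hom_extension: "frame_hom (extension g c)"
  unfolding frame_hom_def
proof (intro conjI allI)
  have "is_complement bot (c bot)" using c[of bot] frame_hom_bot[OF g] by simp
  then have "inf (g top) (c bot) = top" using g by (simp add: is_complement_def frame_hom_def)
  then show "extension g c top = top"
    using extension_upper[of bot top top] by (simp add: rel_top top_unique)
  show "extension g c (inf \<theta> \<phi>) = inf (extension g c \<theta>) (extension g c \<phi>)" for \<theta> \<phi>
    by (intro antisym extension_inf_le inf_greatest extension_mono) simp_all
  show "extension g c (Sup A) = Sup (extension g c ` A)" for A by (rule extension_Sup)
qed

lemma extension_nabla: "extension g c (nabla a) = g a"
proof -
  have "extension g c (nabla a) \<le> m \<longleftrightarrow> g a \<le> m" for m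
  proof -
    have "extension g c (nabla a) \<le> m \<longleftrightarrow> (g bot, g a) \<in> rel (nabla m)"
      by (simp add: extension_adjoint nabla_le_iff Abs_congruence_inverse
          frame_congruence_pullback[OF g])
    also have "\<dots> \<longleftrightarrow> g a \<le> m"
      by (auto simp: rel_nabla frame_hom_bot[OF g] le_iff_sup)
    finally show ?thesis .
  qed
  then show ?thesis by (meson antisym order_refl)
qed

lemma dense_extension:
  assumes "inj g"
  shows "dense_map (extension g c)"
  unfolding dense_map_def
proof (intro allI impI)
  fix \<theta> assume "extension g c \<theta> = bot"
  then have le: "g b \<le> g a" if "(a, b) \<in> rel \<theta>" for a b
    using that extension_le_iff[of \<theta> bot] by auto
  have "a = b" if "(a, b) \<in> rel \<theta>" for a b
    using injD[OF assms] antisym[OF le le] rel_sym that by blast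
  then have "rel \<theta> = Id" by (auto simp: rel_refl)
  then show "\<theta> = bot" by (simp add: rel_inject[symmetric] rel_bot)
qed

end

section \<open>Strictly zero-dimensional biframes as dense quotients\<close>

theorem mainTheorem10:
  fixes M :: "'m::frame biframe_parts"
  assumes "biframe M"
  shows "(strictly_zero_dimensional M \<and>
            (\<exists>g :: 'l::frame \<Rightarrow> 'm. frame_iso_onto g (first_part M)))
         \<longleftrightarrow>
         (\<exists>f :: 'l congruence \<Rightarrow> 'm.
            biframe_hom congruence_biframe M f \<and>
            biframe_surj congruence_biframe M f \<and> dense_map f)"
proof
  assume "strictly_zero_dimensional M \<and>
    (\<exists>g :: 'l \<Rightarrow> 'm. frame_iso_onto g (first_part M))"
  then obtain g :: "'l \<Rightarrow> 'm" where szd: "strictly_zero_dimensional M"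
    and g: "frame_hom g" and "inj g" and range: "range g = first_part M"
    by (auto simp: frame_iso_onto_def bij_betw_def)
  have "\<forall>a. \<exists>c. is_complement (g a) c"
    using szd range unfolding strictly_zero_dimensional_def by blast
  then obtain c where c: "\<And>a. is_complement (g a) (c a)" by metis
  let ?f = "extension g c"
  have hom: "frame_hom ?f" by (rule frame_hom_extension[OF g c])
  have first: "?f ` first_part congruence_biframe = first_part M"
    using range by (simp add: congruence_biframe_def image_image extension_nabla[OF g c])
  have "?f ` second_part congruence_biframe = second_part M"
    using hom_image_second_part[OF hom] szd by (simp add: first strictly_zero_dimensional_def)
  then have "biframe_hom congruence_biframe M ?f \<and> biframe_surj congruence_biframe M ?f"
    using hom first by (simp add: biframe_hom_def biframe_surj_def)
  then show "\<exists>f :: 'l congruence \<Rightarrow> 'm. biframe_hom congruence_biframe M f \<and>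
      biframe_surj congruence_biframe M f \<and> dense_map f"
    using dense_extension[OF g c \<open>inj g\<close>] by blast
next
  assume "\<exists>f :: 'l congruence \<Rightarrow> 'm. biframe_hom congruence_biframe M f \<and>
    biframe_surj congruence_biframe M f \<and> dense_map f"
  then obtain f :: "'l congruence \<Rightarrow> 'm" where f: "frame_hom f" and dense: "dense_map f"
    and first: "f ` first_part congruence_biframe = first_part M"
    and second: "f ` second_part congruence_biframe = second_part M"
    by (auto simp: biframe_hom_def biframe_surj_def)
  have range: "range (f \<circ> nabla) = first_part M"
    using first by (simp add: congruence_biframe_def image_comp)
  have hull: "second_part M = subframe hull {c. \<exists>a\<in>first_part M. is_complement a c}"
    using hom_image_second_part[OF f] by (simp add: first second)
  have "\<exists>d\<in>second_part M. is_complement x d" if x: "x \<in> first_part M" for x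
  proof -
    obtain a where a: "x = f (nabla a)" using x range by auto
    have "is_complement x (f (Delta a))"
      unfolding a by (rule frame_hom_complement[OF f nabla_Delta_complement])
    moreover from this have "f (Delta a) \<in> second_part M"
      unfolding hull using x by (intro subsetD[OF hull_subset]) blast
    ultimately show ?thesis by blast
  qed
  then have szd: "strictly_zero_dimensional M"
    using hull by (simp add: strictly_zero_dimensional_def)
  have "frame_hom (f \<circ> nabla)"
    using f frame_hom_nabla[where 'a = 'l] by (simp add: frame_hom_def image_image)
  then have "frame_iso_onto (f \<circ> nabla) (first_part M)"
    using inj_hom_nabla_of_dense[OF f dense] range
    by (simp add: frame_iso_onto_def bij_betw_def)
  with szd show "strictly_zero_dimensional M \<and>
      (\<exists>g :: 'l \<Rightarrow> 'm. frame_iso_onto g (first_part M))"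
    by blast
qed

end
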